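(* There exist absolute constants $c>0$ and $D_0>0$ such that for every integer $n\ge 2$ and every real $D\ge D_0$ there exists a convex body $K\subset\mathbb{R}^n$ containing a ball of radius $1$ and having diameter $D$, such that the conductance of Coordinate Hit-and-Run on $K$ is at most $\dfrac{c}{n^{1.5}D}$.
   Context: Coordinate Hit-and-Run (CHAR) on a convex body $K\subset\mathbb{R}^n$ is the following Markov chain with state space $K$. Let $e_1,\dots,e_n$ be the standard basis of $\mathbb{R}^n$. From the current point $x\in K$, one step picks $j\in\{1,\dots,n\}$ uniformly at random and moves to a point chosen uniformly at random (with respect to length) from the segment $\ell\cap K$, where $\ell=\{x+te_j: t\in\mathbb{R}\}$. Its stationary distribution is the uniform distribution $\pi_K$ on $K$. For $x\in K$ and measurable $S\subseteq K$, $P_x(S)$ denotes the probability that one step of the chain from $x$ goes to a point in $S$. The conductance of a measurable subset $S\subseteq K$ is $\phi(S)=\dfrac{\int_S P_x(K\setminus S)\,d\pi_K(x)}{\min\{\pi_K(S),\pi_K(K\setminus S)\}}$, and the conductance of the chain is $\phi=\inf\{\phi(S): S\subseteq K \text{ measurable},\ 0<\pi_K(S)\le 1/2\}$. *)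

theory Defs
  imports "HOL-Probability.Probability"
begin

text \<open>
  The constants in the main statement do not depend on the dimension, so the dimension
  has to be a natural number bound inside the formula. Points of $R^n$ are therefore
  extensional functions on \<^term>\<open>{..<n}\<close>, which is the carrier of both the product
  topology and the product measure; the coordinates are numbered from \<open>0\<close> to \<open>n - 1\<close>.
\<close>

definition Rn :: "nat \<Rightarrow> (nat \<Rightarrow> real) set" where
  "Rn n = ({..<n} \<rightarrow>\<^sub>E UNIV)"

definition Rn_top :: "nat \<Rightarrow> (nat \<Rightarrow> real) topology" where
  "Rn_top n = product_topology (\<lambda>_. euclideanreal) {..<n}"

definition Rn_leb :: "nat \<Rightarrow> (nat \<Rightarrow> real) measure" where
  "Rn_leb n = Pi\<^sub>M {..<n} (\<lambda>_. lborel)"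

definition Rn_dist :: "nat \<Rightarrow> (nat \<Rightarrow> real) \<Rightarrow> (nat \<Rightarrow> real) \<Rightarrow> real" where
  "Rn_dist n x y = L2_set (\<lambda>i. x i - y i) {..<n}"

definition Rn_cball :: "nat \<Rightarrow> (nat \<Rightarrow> real) \<Rightarrow> real \<Rightarrow> (nat \<Rightarrow> real) set" where
  "Rn_cball n a r = {x \<in> Rn n. Rn_dist n a x \<le> r}"

definition Rn_convex :: "nat \<Rightarrow> (nat \<Rightarrow> real) set \<Rightarrow> bool" where
  "Rn_convex n K \<longleftrightarrow>
     (\<forall>x\<in>K. \<forall>y\<in>K. \<forall>u\<in>{0..1}. (\<lambda>i\<in>{..<n}. (1 - u) * x i + u * y i) \<in> K)"

definition Rn_diameter :: "nat \<Rightarrow> (nat \<Rightarrow> real) set \<Rightarrow> real" where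
  "Rn_diameter n K = (if K = {} then 0 else (SUP (x, y)\<in>K \<times> K. Rn_dist n x y))"

definition convex_body :: "nat \<Rightarrow> (nat \<Rightarrow> real) set \<Rightarrow> bool" where
  "convex_body n K \<longleftrightarrow>
     Rn_convex n K \<and> compactin (Rn_top n) K \<and> Rn_top n interior_of K \<noteq> {}"

definition unif :: "nat \<Rightarrow> (nat \<Rightarrow> real) set \<Rightarrow> (nat \<Rightarrow> real) measure" where
  "unif n K = uniform_measure (Rn_leb n) K"

text \<open>
  The line through \<open>x\<close> in direction $e_j$ is parametrised by its \<open>j\<close>-th coordinate,
  which preserves length.
\<close>

definition line_section :: "(nat \<Rightarrow> real) set \<Rightarrow> nat \<Rightarrow> (nat \<Rightarrow> real) \<Rightarrow> real set" where
  "line_section K j x = {t. x(j := t) \<in> K}"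

text \<open>
  If the segment has length \<open>0\<close> (for convex \<open>K\<close> it is then the single point \<open>x\<close>), the
  uniform distribution on it is the point mass at \<open>x\<close>; \<^term>\<open>uniform_measure\<close> would
  give the zero measure.
\<close>

definition line_unif ::
    "nat \<Rightarrow> (nat \<Rightarrow> real) set \<Rightarrow> nat \<Rightarrow> (nat \<Rightarrow> real) \<Rightarrow> (nat \<Rightarrow> real) measure" where
  "line_unif n K j x =
     (if emeasure lborel (line_section K j x) = 0
      then return (Rn_leb n) x
      else distr (uniform_measure lborel (line_section K j x)) (Rn_leb n) (\<lambda>t. x(j := t)))"

definition char_prob ::
    "nat \<Rightarrow> (nat \<Rightarrow> real) set \<Rightarrow> (nat \<Rightarrow> real) \<Rightarrow> (nat \<Rightarrow> real) set \<Rightarrow> real" where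
  "char_prob n K x S = (\<Sum>j<n. measure (line_unif n K j x) S) / real n"

definition set_conductance :: "nat \<Rightarrow> (nat \<Rightarrow> real) set \<Rightarrow> (nat \<Rightarrow> real) set \<Rightarrow> real" where
  "set_conductance n K S =
     (LINT x:S|unif n K. char_prob n K x (K - S)) /
     min (measure (unif n K) S) (measure (unif n K) (K - S))"

definition conductance :: "nat \<Rightarrow> (nat \<Rightarrow> real) set \<Rightarrow> real" where
  "conductance n K =
     (INF S \<in> {S \<in> sets (Rn_leb n). S \<subseteq> K \<and>
                 0 < measure (unif n K) S \<and> measure (unif n K) S \<le> 1/2}.
        set_conductance n K S)"

end

theory Submission
  imports Defs
begin

text \<open>
  Write a point as \<open>(s, w, y)\<close> with \<open>s, w\<close> real and \<open>y\<close> in $R^{n-2}$, and let \<open>K\<close> be the sheared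
  tube \<open>0 \<le> s \<le> L\<close>, \<open>|w - s| + |y| \<le> 2\<close>. Only steps in direction $e_0$ change \<open>s\<close>, and these are chosen
  with probability \<open>1/n\<close>. Because the axis of the tube is tilted against $e_0$, the chords in
  direction $e_0$ are short: they have length at most \<open>2(2 - |y|)\<close>. The cross section is a double
  cone over the ball \<open>|y| \<le> 2\<close>, and under its uniform distribution the mean of \<open>2 - |y|\<close> is exactly
  \<open>4/n\<close>. Hence a step from the half \<open>s \<le> L/2\<close> to the other half occurs with probability
  $O(1/n) \cdot O(1/(nL))$, so the conductance is even $O(1/(n^2 D))$.
\<close>

section \<open>The tube and measurability of its coordinate functions\<close>

definition tail_norm :: "nat \<Rightarrow> (nat \<Rightarrow> real) \<Rightarrow> real" where
  "tail_norm n x = L2_set x {2..<n}"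

definition tube :: "nat \<Rightarrow> real \<Rightarrow> (nat \<Rightarrow> real) set" where
  "tube n L = {x \<in> Rn n. 0 \<le> x 0 \<and> x 0 \<le> L \<and> \<bar>x 1 - x 0\<bar> + tail_norm n x \<le> 2}"

lemma tail_norm_nonneg [simp]: "0 \<le> tail_norm n x"
  by (simp add: tail_norm_def)

lemma tail_norm_upd [simp]: "j < 2 \<Longrightarrow> tail_norm n (x(j := t)) = tail_norm n x"
  by (auto simp: tail_norm_def L2_set_def intro!: arg_cong[where f=sqrt] sum.cong)

text \<open>The index set is left open because iterated integration passes through the products over
  \<open>insert 0 {2..<n}\<close> and over \<open>{2..<n}\<close>.\<close>

lemma tail_norm_measurable [measurable]:
  assumes "{2..<n} \<subseteq> I"
  shows "tail_norm n \<in> borel_measurable (Pi\<^sub>M I (\<lambda>_. lborel))"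
proof -
  have "(\<lambda>x. x i) \<in> borel_measurable (Pi\<^sub>M I (\<lambda>_. lborel))" if "i \<in> {2..<n}" for i :: nat
    using measurable_component_singleton[of i I "\<lambda>_. lborel :: real measure"] that assms by auto
  then show ?thesis
    unfolding tail_norm_def [abs_def] L2_set_def by measurable
qed

lemma space_Rn_leb [simp]: "space (Rn_leb n) = Rn n"
  by (simp add: Rn_leb_def Rn_def space_PiM)

lemma coord_measurable [measurable]:
  "i < n \<Longrightarrow> (\<lambda>x. x i) \<in> borel_measurable (Rn_leb n)"
  using measurable_component_singleton[of i "{..<n}" "\<lambda>_. lborel :: real measure"]
  by (simp add: Rn_leb_def)

lemma tail_norm_measurable_Rn [measurable]: "tail_norm n \<in> borel_measurable (Rn_leb n)"
  unfolding Rn_leb_def by (rule tail_norm_measurable) auto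

section \<open>Volumes by iterated integration\<close>

text \<open>For fixed \<open>s\<close> and \<open>y\<close>, the admissible \<open>w\<close> form an
  interval centred at \<open>s\<close> of length \<open>2 * (2 - |y|)\<close>. This length does not
  depend on \<open>s\<close>, so integrating \<open>w\<close> out first removes the shear. When
  \<open>|y| > 2\<close> the interval is empty and \<open>ennreal\<close> sends the negative length
  to 0, so the integral over \<open>y\<close> needs no explicit cutoff.\<close>

lemma emeasure_slice:
  fixes P :: "real \<Rightarrow> real \<Rightarrow> bool"
  assumes n: "n \<ge> 2" and P [measurable]: "Measurable.pred (borel \<Otimes>\<^sub>M borel) (case_prod P)"
  shows "emeasure (Rn_leb n) {x \<in> Rn n. P (x 0) (tail_norm n x) \<and> \<bar>x 1 - x 0\<bar> + tail_norm n x \<le> 2} =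
    (\<integral>\<^sup>+y. ennreal (2 * (2 - tail_norm n y)) * emeasure lborel {s. P s (tail_norm n y)}
       \<partial>Pi\<^sub>M {2..<n} (\<lambda>_. lborel))"
proof -
  interpret product_sigma_finite "\<lambda>_::nat. lborel :: real measure" ..
  let ?X = "{x \<in> Rn n. P (x 0) (tail_norm n x) \<and> \<bar>x 1 - x 0\<bar> + tail_norm n x \<le> 2}"
  define Q where "Q r s w \<longleftrightarrow> P s r \<and> \<bar>w - s\<bar> + r \<le> 2" for r s w
  have [measurable]: "(\<lambda>x. x 0) \<in> borel_measurable (Rn_leb n)" "(\<lambda>x. x 1) \<in> borel_measurable (Rn_leb n)"
    using n by auto
  have [measurable]: "?X \<in> sets (Rn_leb n)"
    unfolding space_Rn_leb[symmetric] by measurable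
  \<comment> \<open>The outermost index is the one that \<open>product_nn_integral_insert\<close>
    integrates out first: coordinate 1, then coordinate 0.\<close>
  have ins: "{..<n} = insert 1 (insert 0 {2..<n})"
    using n by auto
  let ?f = "\<lambda>x. indicator {x. Q (tail_norm n x) (x 0) (x 1)} x :: ennreal"
  have f: "?f \<in> borel_measurable (Rn_leb n)"
    unfolding Q_def by measurable
  have f0: "?f \<in> borel_measurable (Pi\<^sub>M (insert 1 (insert 0 {2..<n})) (\<lambda>_. lborel))"
    using f by (simp add: Rn_leb_def ins)
  have w: "(\<integral>\<^sup>+w. ?f (x(1 := w)) \<partial>lborel) = 
      indicator {x. P (x 0) (tail_norm n x)} x * ennreal (2 * (2 - tail_norm n x))" for x
  proof -
    have "?f (x(1 := w)) = indicator {x. P (x 0) (tail_norm n x)} x *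
       indicator {x 0 - (2 - tail_norm n x)..x 0 + (2 - tail_norm n x)} w" for w
      by (auto simp: indicator_def Q_def)
    then have "(\<integral>\<^sup>+w. ?f (x(1 := w)) \<partial>lborel) = indicator {x. P (x 0) (tail_norm n x)} x *
       emeasure lborel {x 0 - (2 - tail_norm n x)..x 0 + (2 - tail_norm n x)}"
      by (simp add: nn_integral_cmult)
    also have "emeasure lborel {x 0 - (2 - tail_norm n x)..x 0 + (2 - tail_norm n x)} =
        ennreal (2 * (2 - tail_norm n x))"
      by (subst emeasure_lborel_Icc_eq) (auto simp: ennreal_neg)
    finally show ?thesis .
  qed
  have [measurable]: "tail_norm n \<in> borel_measurable (Pi\<^sub>M (insert 0 {2..<n}) (\<lambda>_. lborel))"
    by (rule tail_norm_measurable) auto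
  have [measurable]: "(\<lambda>x. x 0) \<in> borel_measurable (Pi\<^sub>M (insert 0 {2..<n}) (\<lambda>_. lborel :: real measure))"
    using measurable_component_singleton[of 0 "insert 0 {2..<n}" "\<lambda>_. lborel :: real measure"] by simp
  have "emeasure (Rn_leb n) ?X = (\<integral>\<^sup>+x. indicator ?X x \<partial>Rn_leb n)"
    by (rule nn_integral_indicator[symmetric]) fact
  also have "\<dots> = (\<integral>\<^sup>+x. ?f x \<partial>Rn_leb n)"
    by (intro nn_integral_cong) (auto simp: indicator_def Q_def)
  also have "\<dots> = (\<integral>\<^sup>+x. \<integral>\<^sup>+w. ?f (x(1 := w)) \<partial>lborel \<partial>Pi\<^sub>M (insert 0 {2..<n}) (\<lambda>_. lborel))"
    unfolding Rn_leb_def ins by (rule product_nn_integral_insert) (use f0 in auto)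
  also have "\<dots> = (\<integral>\<^sup>+x. indicator {x. P (x 0) (tail_norm n x)} x * ennreal (2 * (2 - tail_norm n x))
       \<partial>Pi\<^sub>M (insert 0 {2..<n}) (\<lambda>_. lborel))"
    by (simp only: w)
  also have "\<dots> = (\<integral>\<^sup>+y. \<integral>\<^sup>+s. indicator {s. P s (tail_norm n y)} s * ennreal (2 * (2 - tail_norm n y)) \<partial>lborel
       \<partial>Pi\<^sub>M {2..<n} (\<lambda>_. lborel))"
    by (subst product_nn_integral_insert) (auto simp: indicator_def)
  also have "\<dots> = (\<integral>\<^sup>+y. ennreal (2 * (2 - tail_norm n y)) * emeasure lborel {s. P s (tail_norm n y)}
       \<partial>Pi\<^sub>M {2..<n} (\<lambda>_. lborel))"
    by (intro nn_integral_cong) (simp add: nn_integral_multc mult.commute)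
  finally show ?thesis .
qed

lemma emeasure_tail_ball:
  assumes "r > 0"
  shows "emeasure (Pi\<^sub>M {2..<n} (\<lambda>_. lborel)) {y \<in> space (Pi\<^sub>M {2..<n} (\<lambda>_. lborel)). tail_norm n y \<le> r} =
    ennreal (unit_ball_vol (real (n - 2)) * r ^ (n - 2))"
proof -
  have "{y \<in> space (Pi\<^sub>M {2..<n} (\<lambda>_. lborel)). tail_norm n y \<le> r} =
     {f. sqrt (\<Sum>i\<in>{2..<n}. (f i)\<^sup>2) \<le> r} \<inter> space (Pi\<^sub>M {2..<n} (\<lambda>_. lborel))"
    by (auto simp: tail_norm_def L2_set_def)
  then show ?thesis
    using emeasure_cball_aux[of "{2..<n}" r] assms by simp
qed

text \<open>Layer-cake argument: after exchanging the integrals, the inner one is the volume of the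
  ball \<open>|y| <= t\<close>, which is \<open>V * t ^ (n - 2)\<close>. Integrals of functions of
  \<open>|y|\<close> thereby become integrals over the real interval from 0 to 2.\<close>

lemma nn_integral_layers:
  assumes [measurable]: "w \<in> borel_measurable borel"
  shows "(\<integral>\<^sup>+y. (\<integral>\<^sup>+t. ennreal (w t) * indicator {tail_norm n y..2} t \<partial>lborel) \<partial>Pi\<^sub>M {2..<n} (\<lambda>_. lborel)) =
    ennreal (unit_ball_vol (real (n - 2))) * (\<integral>\<^sup>+t. ennreal (w t * t ^ (n - 2)) * indicator {0..2} t \<partial>lborel)"
proof -
  let ?M = "Pi\<^sub>M {2..<n} (\<lambda>_. lborel :: real measure)"
  interpret product_sigma_finite "\<lambda>_::nat. lborel :: real measure" ..
  interpret I: sigma_finite_measure ?M by (rule sigma_finite) simp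
  interpret pair_sigma_finite ?M "lborel :: real measure" ..
  have [measurable]: "tail_norm n \<in> borel_measurable ?M"
    by (rule tail_norm_measurable) simp
  have "(\<integral>\<^sup>+y. (\<integral>\<^sup>+t. ennreal (w t) * indicator {tail_norm n y..2} t \<partial>lborel) \<partial>?M) =
     (\<integral>\<^sup>+y. (\<integral>\<^sup>+t. ennreal (w t) * indicator {0..2} t * (if tail_norm n y \<le> t then 1 else 0) \<partial>lborel) \<partial>?M)"
    by (intro nn_integral_cong) (auto simp: indicator_def intro: order_trans[OF tail_norm_nonneg])
  also have "\<dots> = (\<integral>\<^sup>+t. (\<integral>\<^sup>+y. ennreal (w t) * indicator {0..2} t * (if tail_norm n y \<le> t then 1 else 0) \<partial>?M) \<partial>lborel)"
    by (rule Fubini'[symmetric]) measurable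
  also have "\<dots> = (\<integral>\<^sup>+t. ennreal (w t) * indicator {0..2} t * emeasure ?M {y \<in> space ?M. tail_norm n y \<le> t} \<partial>lborel)"
  proof (intro nn_integral_cong)
    fix t :: real
    have "(\<integral>\<^sup>+y. (if tail_norm n y \<le> t then 1 else 0) \<partial>?M) = (\<integral>\<^sup>+y. indicator {y \<in> space ?M. tail_norm n y \<le> t} y \<partial>?M)"
      by (intro nn_integral_cong) (auto simp: indicator_def)
    then show "(\<integral>\<^sup>+y. ennreal (w t) * indicator {0..2} t * (if tail_norm n y \<le> t then 1 else 0) \<partial>?M) =
       ennreal (w t) * indicator {0..2} t * emeasure ?M {y \<in> space ?M. tail_norm n y \<le> t}"
      by (simp add: nn_integral_cmult)
  qed
  also have "\<dots> = (\<integral>\<^sup>+t. ennreal (unit_ball_vol (real (n - 2))) * (ennreal (w t * t ^ (n - 2)) * indicator {0..2} t) \<partial>lborel)"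
  \<comment> \<open>The ball volume formula is available for \<open>t > 0\<close>. The indicator
    removes \<open>t < 0\<close>, and \<open>t = 0\<close> is a null set.\<close>
  proof (rule nn_integral_cong_AE)
    show "AE t in lborel. ennreal (w t) * indicator {0..2} t * emeasure ?M {y \<in> space ?M. tail_norm n y \<le> t} =
       ennreal (unit_ball_vol (real (n - 2))) * (ennreal (w t * t ^ (n - 2)) * indicator {0..2} t)"
      using AE_lborel_singleton[of "0::real"]
      by eventually_elim
        (auto simp: indicator_def emeasure_tail_ball ennreal_mult' ennreal_mult'' mult_ac)
  qed
  finally show ?thesis
    by (simp add: nn_integral_cmult)
qed

text \<open>The quotient of the second integral by the first is \<open>4 / n\<close>. It is the mean
  of \<open>2 - |y|\<close> over a cross section, because \<open>y\<close> has density proportional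
  to \<open>2 - |y|\<close> there. The second integrand needs an explicit \<open>max 0\<close>,
  since squaring would make the negative values count; in the first, \<open>ennreal\<close>
  truncates.\<close>

lemma nn_integral_slack:
  assumes "n \<ge> 2"
  defines "V \<equiv> unit_ball_vol (real (n - 2))"
  shows "(\<integral>\<^sup>+y. ennreal (2 - tail_norm n y) \<partial>Pi\<^sub>M {2..<n} (\<lambda>_. lborel)) =
      ennreal (V * 2 ^ (n - 1) / real (n - 1))" (is ?a)
    and "(\<integral>\<^sup>+y. ennreal ((max 0 (2 - tail_norm n y))\<^sup>2) \<partial>Pi\<^sub>M {2..<n} (\<lambda>_. lborel)) =
      ennreal (V * 2 ^ (n + 1) / (real (n - 1) * real n))" (is ?b)
proof -
  obtain m where m: "n = m + 2"
    using assms(1) by (metis add.commute le_Suc_ex)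
  have V: "V \<ge> 0" by (simp add: V_def)
  \<comment> \<open>Both integrands are put into layer form: the weight 1 produces
    \<open>2 - r\<close>, and the weight \<open>2 * (2 - t)\<close>, with antiderivative
    \<open>- (2 - t)^2\<close>, produces its square.\<close>
  have e1: "ennreal (2 - r) = (\<integral>\<^sup>+t. ennreal 1 * indicator {r..2} t \<partial>lborel)" for r :: real
    by (cases "r \<le> 2") (auto simp: emeasure_lborel_Icc_eq ennreal_neg)
  have e2: "ennreal ((max 0 (2 - r))\<^sup>2) = (\<integral>\<^sup>+t. ennreal (2 * (2 - t)) * indicator {r..2} t \<partial>lborel)" for r :: real
  proof (cases "r \<le> 2")
    case True
    have "(\<integral>\<^sup>+t. ennreal (2 * (2 - t)) * indicator {r..2} t \<partial>lborel) = ennreal (- (2 - 2)\<^sup>2 - - (2 - r)\<^sup>2)"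
      by (rule nn_integral_FTC_Icc)
        (use True in \<open>auto intro!: derivative_eq_intros\<close>)
    then show ?thesis using True by simp
  qed simp
  have d: "((\<lambda>t. t ^ (k + 1) / real (k + 1)) has_real_derivative t ^ k) (at t within X)"
    for k :: nat and t :: real and X
    using DERIV_power_Suc[OF DERIV_ident, of k t X] DERIV_cdivide[where c = "real (k + 1)"]
    by fastforce
  have "(\<integral>\<^sup>+t. ennreal (1 * t ^ m) * indicator {0..2} t \<partial>lborel) =
      ennreal (2 ^ (m + 1) / real (m + 1) - 0 ^ (m + 1) / real (m + 1))"
    by (rule nn_integral_FTC_Icc[where F = "\<lambda>t. t ^ (m + 1) / real (m + 1)"])
      (use d in \<open>auto simp del: of_nat_Suc\<close>)
  then show ?a
    unfolding e1 by (subst nn_integral_layers) (auto simp: m V V_def simp flip: ennreal_mult')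
  have "(\<integral>\<^sup>+t. ennreal (2 * (2 - t) * t ^ m) * indicator {0..2} t \<partial>lborel) =
      ennreal ((4 * (2 ^ (m + 1) / real (m + 1)) - 2 * (2 ^ (m + 1 + 1) / real (m + 1 + 1)))
        - (4 * (0 ^ (m + 1) / real (m + 1)) - 2 * (0 ^ (m + 1 + 1) / real (m + 1 + 1))))"
  proof (rule nn_integral_FTC_Icc[where F = "\<lambda>t. 4 * (t ^ (m + 1) / real (m + 1)) - 2 * (t ^ (m + 1 + 1) / real (m + 1 + 1))"])
    fix t :: real assume "t \<in> {0..2}"
    then show "2 * (2 - t) * t ^ m \<ge> 0" by simp
    have "((\<lambda>t. 4 * (t ^ (m + 1) / real (m + 1)) - 2 * (t ^ (m + 1 + 1) / real (m + 1 + 1)))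
        has_real_derivative 4 * t ^ m - 2 * t ^ (m + 1)) (at t)"
      by (intro DERIV_diff DERIV_cmult d)
    then show "((\<lambda>t. 4 * (t ^ (m + 1) / real (m + 1)) - 2 * (t ^ (m + 1 + 1) / real (m + 1 + 1)))
        has_real_derivative 2 * (2 - t) * t ^ m) (at t)"
      by (simp add: algebra_simps)
  qed auto
  also have "(4 * (2 ^ (m + 1) / real (m + 1)) - 2 * (2 ^ (m + 1 + 1) / real (m + 1 + 1)))
        - (4 * (0 ^ (m + 1) / real (m + 1)) - 2 * (0 ^ (m + 1 + 1) / real (m + 1 + 1))) =
      2 ^ (m + 3) / (real (m + 1) * real (m + 2))"
    by (simp add: divide_simps) (simp add: algebra_simps power_add)
  finally show ?b
    unfolding e2 by (subst nn_integral_layers)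
      (auto simp: m V V_def eval_nat_numeral simp del: of_nat_Suc simp flip: ennreal_mult')
qed

section \<open>The test set, its collar and their volumes\<close>

definition half :: "nat \<Rightarrow> real \<Rightarrow> (nat \<Rightarrow> real) set" where
  "half n L = {x \<in> tube n L. x 0 \<le> L / 2}"

text \<open>
  Contains every point of \<^term>\<open>half n L\<close> whose chord in direction $e_0$ leaves \<^term>\<open>half n L\<close>,
  since that chord has length at most \<open>2(2 - |y|)\<close>.
\<close>

definition collar :: "nat \<Rightarrow> real \<Rightarrow> (nat \<Rightarrow> real) set" where
  "collar n L = {x \<in> half n L. L / 2 - 2 * (2 - tail_norm n x) < x 0}"

text \<open>The (n-1)-dimensional volume of a slice of the tube at fixed \<open>x 0\<close>: the
  chord length \<open>2 * (2 - |y|)\<close> in direction 1, integrated over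
  \<open>y\<close>.\<close>

definition section_area :: "nat \<Rightarrow> real" where
  "section_area n = 2 * (unit_ball_vol (real (n - 2)) * 2 ^ (n - 1) / real (n - 1))"

lemma section_area_pos: "n \<ge> 2 \<Longrightarrow> section_area n > 0"
  by (simp add: section_area_def)

lemma tube_sets [measurable]: "n \<ge> 2 \<Longrightarrow> tube n L \<in> sets (Rn_leb n)"
  unfolding tube_def space_Rn_leb[symmetric] by measurable

lemma half_sets [measurable]: "n \<ge> 2 \<Longrightarrow> half n L \<in> sets (Rn_leb n)"
proof -
  assume n: "n \<ge> 2"
  then have [measurable]: "(\<lambda>x. x 0) \<in> borel_measurable (Rn_leb n)" by simp
  have "half n L = tube n L \<inter> {x \<in> space (Rn_leb n). x 0 \<le> L / 2}"
    by (auto simp: half_def tube_def)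
  also have "\<dots> \<in> sets (Rn_leb n)"
    using n by (intro sets.Int tube_sets) measurable
  finally show ?thesis .
qed

lemma collar_sets [measurable]: "n \<ge> 2 \<Longrightarrow> collar n L \<in> sets (Rn_leb n)"
proof -
  assume n: "n \<ge> 2"
  then have [measurable]: "(\<lambda>x. x 0) \<in> borel_measurable (Rn_leb n)" by simp
  have "collar n L = half n L \<inter> {x \<in> space (Rn_leb n). L / 2 - 2 * (2 - tail_norm n x) < x 0}"
    by (auto simp: collar_def half_def tube_def)
  also have "\<dots> \<in> sets (Rn_leb n)"
    using n by (intro sets.Int half_sets) measurable
  finally show ?thesis .
qed

text \<open>All slices have the same area, so the volume is linear in \<open>b\<close>. The cases
  \<open>b = L\<close> and \<open>b = L / 2\<close> give the tube and its half.\<close>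

lemma emeasure_tube_initial:
  assumes n: "n \<ge> 2" and b: "0 \<le> b" "b \<le> L"
  shows "emeasure (Rn_leb n) {x \<in> tube n L. x 0 \<le> b} = ennreal (b * section_area n)"
proof -
  have [measurable]: "tail_norm n \<in> borel_measurable (Pi\<^sub>M {2..<n} (\<lambda>_. lborel))"
    by (rule tail_norm_measurable) simp
  have "{x \<in> tube n L. x 0 \<le> b} =
      {x \<in> Rn n. (0 \<le> x 0 \<and> x 0 \<le> b) \<and> \<bar>x 1 - x 0\<bar> + tail_norm n x \<le> 2}"
    using b by (auto simp: tube_def)
  then have "emeasure (Rn_leb n) {x \<in> tube n L. x 0 \<le> b} =
      (\<integral>\<^sup>+y. ennreal (2 * (2 - tail_norm n y)) * emeasure lborel {s. 0 \<le> s \<and> s \<le> b} \<partial>Pi\<^sub>M {2..<n} (\<lambda>_. lborel))"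
    using emeasure_slice[OF n, of "\<lambda>s r. 0 \<le> s \<and> s \<le> b"] by simp
  also have "{s. 0 \<le> s \<and> s \<le> b} = {0..b}"
    by auto
  also have "(\<integral>\<^sup>+y. ennreal (2 * (2 - tail_norm n y)) * emeasure lborel {0..b} \<partial>Pi\<^sub>M {2..<n} (\<lambda>_. lborel)) =
      (\<integral>\<^sup>+y. ennreal (2 * b) * ennreal (2 - tail_norm n y) \<partial>Pi\<^sub>M {2..<n} (\<lambda>_. lborel))"
    using b by (intro nn_integral_cong)
      (simp add: ennreal_mult' mult_ac del: right_diff_distrib_numeral)
  also have "\<dots> = ennreal (b * section_area n)"
    using b n
    by (subst nn_integral_cmult) (auto simp: nn_integral_slack section_area_def mult_ac simp flip: ennreal_mult)
  finally show ?thesis .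
qed

lemma emeasure_tube:
  assumes "n \<ge> 2" "0 \<le> L"
  shows "emeasure (Rn_leb n) (tube n L) = ennreal (L * section_area n)"
proof -
  have "tube n L = {x \<in> tube n L. x 0 \<le> L}"
    by (auto simp: tube_def)
  then show ?thesis
    using emeasure_tube_initial[of n L L] assms by simp
qed

lemma emeasure_half:
  assumes "n \<ge> 2" "0 \<le> L"
  shows "emeasure (Rn_leb n) (half n L) = ennreal (L / 2 * section_area n)"
  using emeasure_tube_initial[of n "L / 2" L] assms by (simp add: half_def)

text \<open>For fixed \<open>y\<close>, both \<open>w\<close> and \<open>s\<close> range over sets
  of length at most \<open>2 * (2 - |y|)\<close>, which leaves the second moment
  \<open>4 * (2 - |y|)^2\<close>. Relative to \<open>section_area n\<close> this integrates to twice
  the mean \<open>4 / n\<close>.\<close>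

lemma emeasure_collar_le:
  assumes n: "n \<ge> 2" and L: "0 \<le> L"
  shows "emeasure (Rn_leb n) (collar n L) \<le> ennreal (8 / real n * section_area n)"
proof -
  let ?P = "\<lambda>s r. 0 \<le> s \<and> s \<le> L / 2 \<and> L / 2 - 2 * (2 - r) < s"
  have [measurable]: "tail_norm n \<in> borel_measurable (Pi\<^sub>M {2..<n} (\<lambda>_. lborel))"
    by (rule tail_norm_measurable) simp
  have "collar n L =
      {x \<in> Rn n. ?P (x 0) (tail_norm n x) \<and> \<bar>x 1 - x 0\<bar> + tail_norm n x \<le> 2}"
    using L by (auto simp: collar_def half_def tube_def)
  then have "emeasure (Rn_leb n) (collar n L) =
      (\<integral>\<^sup>+y. ennreal (2 * (2 - tail_norm n y)) * emeasure lborel {s. ?P s (tail_norm n y)} \<partial>Pi\<^sub>M {2..<n} (\<lambda>_. lborel))"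
    using emeasure_slice[OF n, of ?P] by simp
  also have "\<dots> \<le> (\<integral>\<^sup>+y. 4 * ennreal ((max 0 (2 - tail_norm n y))\<^sup>2) \<partial>Pi\<^sub>M {2..<n} (\<lambda>_. lborel))"
  proof (rule nn_integral_mono)
    fix y
    show "ennreal (2 * (2 - tail_norm n y)) * emeasure lborel {s. ?P s (tail_norm n y)}
       \<le> 4 * ennreal ((max 0 (2 - tail_norm n y))\<^sup>2)"
    proof (cases "tail_norm n y \<le> 2")
      case True
      have "emeasure lborel {s. ?P s (tail_norm n y)} \<le> emeasure lborel {L / 2 - 2 * (2 - tail_norm n y)..L / 2}"
        by (intro emeasure_mono) auto
      also have "\<dots> = ennreal (2 * (2 - tail_norm n y))"
        using True by simp
      finally have "ennreal (2 * (2 - tail_norm n y)) * emeasure lborel {s. ?P s (tail_norm n y)} \<le>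
          ennreal (2 * (2 - tail_norm n y)) * ennreal (2 * (2 - tail_norm n y))"
        by (rule mult_left_mono) simp
      also have "\<dots> = ennreal (4 * (2 - tail_norm n y)\<^sup>2)"
        using True by (subst ennreal_mult[symmetric]) (auto simp: power2_eq_square algebra_simps)
      also have "\<dots> = 4 * ennreal ((max 0 (2 - tail_norm n y))\<^sup>2)"
        using True by (simp add: ennreal_mult)
      finally show ?thesis .
    qed (simp add: ennreal_neg)
  qed
  also have "\<dots> = ennreal 4 * ennreal (unit_ball_vol (real (n - 2)) * 2 ^ (n + 1) / (real (n - 1) * real n))"
    using n by (subst nn_integral_cmult) (auto simp: nn_integral_slack)
  also have "\<dots> = ennreal (4 * (unit_ball_vol (real (n - 2)) * 2 ^ (n + 1) / (real (n - 1) * real n)))"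
    by (subst ennreal_mult') auto
  also have "4 * (unit_ball_vol (real (n - 2)) * 2 ^ (n + 1) / (real (n - 1) * real n)) = 8 / real n * section_area n"
    using n by (cases n) (auto simp: section_area_def field_simps)
  finally show ?thesis .
qed

section \<open>One step of the chain from the half tube\<close>

lemma measurable_line:
  assumes "x \<in> Rn n" "j < n"
  shows "(\<lambda>t. x(j := t)) \<in> uniform_measure lborel X \<rightarrow>\<^sub>M Rn_leb n"
  unfolding Rn_leb_def
proof (rule measurable_PiM_single')
  show "(\<lambda>t. x(j := t)) \<in> space (uniform_measure lborel X) \<rightarrow> (\<Pi>\<^sub>E i\<in>{..<n}. space lborel)"
    using assms by (auto simp: Rn_def PiE_def extensional_def)
  show "(\<lambda>t. (x(j := t)) i) \<in> uniform_measure lborel X \<rightarrow>\<^sub>M lborel" for i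
    by (cases "i = j") (auto intro: measurable_ident_sets)
qed

lemma emeasure_line_section_tube_finite: "emeasure lborel (line_section (tube n L) 0 x) \<noteq> \<infinity>"
proof -
  have "emeasure lborel (line_section (tube n L) 0 x) \<le> emeasure lborel {0..L}"
    by (rule emeasure_mono) (auto simp: line_section_def tube_def)
  then show ?thesis
    by (auto simp: top_unique emeasure_lborel_Icc_eq)
qed

text \<open>The assumption \<open>x \<notin> A\<close> serves the degenerate chord, where the step
  is a point mass at \<open>x\<close>; the assumption on the whole line serves the other
  case.\<close>

lemma measure_line_unif_eq_0:
  assumes "x \<in> Rn n" "j < n" "A \<in> sets (Rn_leb n)" "x \<notin> A" "\<And>t. x(j := t) \<notin> A"
  shows "measure (line_unif n K j x) A = 0"
proof (cases "emeasure lborel (line_section K j x) = 0")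
  case True
  then show ?thesis
    using assms by (simp add: line_unif_def measure_return)
next
  case False
  have "(\<lambda>t. x(j := t)) -` A = {}"
    using assms by auto
  then have "measure (distr (uniform_measure lborel (line_section K j x)) (Rn_leb n) (\<lambda>t. x(j := t))) A = 0"
    using measure_distr[OF measurable_line[OF assms(1,2)] assms(3), of "line_section K j x"] by simp
  then show ?thesis
    using False by (simp add: line_unif_def)
qed

lemma measure_line_unif_le_1:
  assumes "x \<in> Rn n" "n > 0"
  shows "measure (line_unif n (tube n L) 0 x) A \<le> 1"
proof (cases "emeasure lborel (line_section (tube n L) 0 x) = 0")
  case True
  interpret prob_space "return (Rn_leb n) x"
    using assms by (intro prob_space_return) simp
  show ?thesis using True by (simp add: line_unif_def)
next
  case False
  interpret U: prob_space "uniform_measure lborel (line_section (tube n L) 0 x)"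
    using False emeasure_line_section_tube_finite by (intro prob_space_uniform_measure) auto
  interpret prob_space "distr (uniform_measure lborel (line_section (tube n L) 0 x)) (Rn_leb n) (\<lambda>t. x(0 := t))"
    using assms by (intro U.prob_space_distr measurable_line) auto
  show ?thesis using False by (simp add: line_unif_def)
qed

text \<open>A step in a direction other than 0 keeps \<open>x 0\<close>, so it cannot leave the half
  while staying in the tube. Direction 0 is chosen with probability \<open>1 / n\<close>; its escape
  probability is bounded by 1 on the collar and vanishes elsewhere.\<close>

lemma char_prob_half_le:
  assumes n: "n \<ge> 2" and x: "x \<in> half n L"
  shows "char_prob n (tube n L) x (tube n L - half n L) \<le> indicator (collar n L) x / real n"
proof -
  let ?A = "tube n L - half n L"
  have xR: "x \<in> Rn n" using x by (auto simp: half_def tube_def)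
  have A: "?A \<in> sets (Rn_leb n)" using n by simp
  have "measure (line_unif n (tube n L) j x) ?A = 0" if "j \<in> {..<n} - {0}" for j
    by (rule measure_line_unif_eq_0) (use that A x xR in \<open>auto simp: half_def\<close>)
  then have "(\<Sum>j<n. measure (line_unif n (tube n L) j x) ?A) = measure (line_unif n (tube n L) 0 x) ?A"
    using n by (subst sum.remove[of _ 0]) auto
  also have "\<dots> \<le> indicator (collar n L) x"
  proof (cases "x \<in> collar n L")
    case True
    then show ?thesis using measure_line_unif_le_1[OF xR] n by simp
  next
    case False
    \<comment> \<open>If \<open>x\<close> and \<open>x(0 := t)\<close> both lie in the tube, then
      \<open>x 0\<close> and \<open>t\<close> are within \<open>2 - |y|\<close> of
      \<open>x 1\<close>, hence within \<open>2 * (2 - |y|)\<close> of each other. So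
      \<open>t > L / 2\<close> would put \<open>x\<close> in the collar.\<close>
    have "x(0 := t) \<notin> ?A" for t
      using False x by (auto simp: collar_def half_def tube_def)
    then have "measure (line_unif n (tube n L) 0 x) ?A = 0"
      by (intro measure_line_unif_eq_0) (use n A x xR in auto)
    then show ?thesis by simp
  qed
  finally show ?thesis
    unfolding char_prob_def by (rule divide_right_mono) simp
qed

section \<open>The conductance bound\<close>

text \<open>An infimum of reals lies below its members only if the family is bounded below; here 0
  is a bound, as flow and denominator are nonnegative.\<close>

lemma conductance_le_set_conductance:
  assumes "S \<in> sets (Rn_leb n)" "S \<subseteq> K" "0 < measure (unif n K) S" "measure (unif n K) S \<le> 1 / 2"
  shows "conductance n K \<le> set_conductance n K S"
  unfolding conductance_def
proof (rule cINF_lower)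
  have "0 \<le> set_conductance n K S" for S
    unfolding set_conductance_def set_lebesgue_integral_def char_prob_def
    by (intro divide_nonneg_nonneg integral_nonneg_AE AE_I2 scaleR_nonneg_nonneg sum_nonneg) auto
  then show "bdd_below (set_conductance n K ` {S \<in> sets (Rn_leb n). S \<subseteq> K \<and> 0 < measure (unif n K) S \<and> measure (unif n K) S \<le> 1 / 2})"
    by (intro bdd_belowI[of _ 0]) auto
qed (use assms in auto)

lemma measure_unif_tube:
  assumes n: "n \<ge> 2" and L: "0 < L" and S: "S \<in> sets (Rn_leb n)" "S \<subseteq> tube n L"
  shows "measure (unif n (tube n L)) S = measure (Rn_leb n) S / (L * section_area n)"
proof -
  note pos = section_area_pos[OF n]
  have "measure (unif n (tube n L)) S = measure (Rn_leb n) (tube n L \<inter> S) / measure (Rn_leb n) (tube n L)"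
    unfolding unif_def
    using n L S pos by (intro measure_uniform_measure) (auto simp: emeasure_tube)
  also have "tube n L \<inter> S = S" using S by auto
  also have "measure (Rn_leb n) (tube n L) = L * section_area n"
    using n L pos by (simp add: measure_def emeasure_tube)
  finally show ?thesis .
qed

text \<open>The half tube has mass exactly 1/2, so it is admissible and the denominator is 1/2. The
  flow out of it is at most the mass \<open>8 / (n * L)\<close> of the collar divided by
  \<open>n\<close>.\<close>

lemma conductance_tube_le:
  assumes n: "n \<ge> 2" and L: "0 < L"
  shows "conductance n (tube n L) \<le> 16 / ((real n)\<^sup>2 * L)"
proof -
  let ?K = "tube n L" and ?S = "half n L" and ?T = "collar n L"
  let ?U = "unif n ?K" and ?a = "section_area n"
  note pos = section_area_pos[OF n]
  have sub: "?S \<subseteq> ?K" "?T \<subseteq> ?K" by (auto simp: half_def collar_def)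
  interpret prob_space ?U
    unfolding unif_def
    using n L pos by (intro prob_space_uniform_measure) (auto simp: emeasure_tube)
  have "measure (Rn_leb n) ?S = L / 2 * ?a"
    using n L pos by (simp add: measure_def emeasure_half)
  then have S: "measure ?U ?S = 1 / 2"
    using n L pos sub by (simp add: measure_unif_tube field_simps)
  have "measure (Rn_leb n) ?K = L * ?a"
    using n L pos by (simp add: measure_def emeasure_tube)
  then have "measure ?U ?K = 1"
    using n L pos by (simp add: measure_unif_tube)
  moreover have sets: "?S \<in> sets ?U" "?K \<in> sets ?U" "?T \<in> sets ?U"
    using n by (auto simp: unif_def)
  ultimately have KS: "measure ?U (?K - ?S) = 1 / 2"
    using sub S by (subst finite_measure_Diff) auto
  have "measure (Rn_leb n) ?T \<le> 8 / real n * ?a"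
    using emeasure_collar_le[of n L] n L pos unfolding measure_def by (intro enn2real_leI) auto
  then have "measure (Rn_leb n) ?T / (L * ?a) \<le> (8 / real n * ?a) / (L * ?a)"
    using L pos by (intro divide_right_mono) auto
  also have "\<dots> = 8 / (real n * L)"
    using pos by simp
  finally have T: "measure ?U ?T \<le> 8 / (real n * L)"
    using n L sub by (simp add: measure_unif_tube)
  have "(LINT x:?S|?U. char_prob n ?K x (?K - ?S)) \<le> (LINT x|?U. indicator ?T x / real n)"
    unfolding set_lebesgue_integral_def
  \<comment> \<open>Integrability and nonnegativity are asked of the majorant only: a non-integrable
    left integrand would have integral 0 by convention.\<close>
  proof (rule integral_mono')
    show "integrable ?U (\<lambda>x. indicator ?T x / real n)"
      using sets by (auto intro: integrable_divide simp: emeasure_eq_measure)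
    show "indicator ?S x *\<^sub>R char_prob n ?K x (?K - ?S) \<le> indicator ?T x / real n" for x
      using char_prob_half_le[OF n, of x L] by (cases "x \<in> ?S") auto
  qed auto
  also have "\<dots> = measure ?U ?T / real n"
    using sets by simp
  also have "\<dots> \<le> 8 / (real n * L) / real n"
    using T by (rule divide_right_mono) simp
  finally have "set_conductance n ?K ?S \<le> (8 / (real n * L) / real n) / (1 / 2)"
    unfolding set_conductance_def S KS by (simp add: divide_right_mono)
  also have "\<dots> = 16 / ((real n)\<^sup>2 * L)"
    by (simp add: power2_eq_square)
  finally show ?thesis
    using conductance_le_set_conductance[of ?S n ?K] n S sub by simp
qed

section \<open>Geometry of the tube: convexity, compactness, inner ball, diameter\<close>

lemma Rn_dist_eq:
  assumes "n \<ge> 2"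
  shows "(Rn_dist n x y)\<^sup>2 = (x 0 - y 0)\<^sup>2 + (x 1 - y 1)\<^sup>2 + (tail_norm n (\<lambda>i. x i - y i))\<^sup>2"
proof -
  have "{..<n} = insert 0 (insert 1 {2..<n})"
    using assms by auto
  then show ?thesis
    by (simp add: Rn_dist_def tail_norm_def)
qed

lemma tail_norm_triangle: "tail_norm n (\<lambda>i. x i + y i) \<le> tail_norm n x + tail_norm n y"
  unfolding tail_norm_def by (rule L2_set_triangle_ineq)

lemma tail_norm_minus: "tail_norm n (\<lambda>i. - x i) = tail_norm n x"
  by (simp add: tail_norm_def L2_set_def)

lemma tail_norm_cmult: "0 \<le> c \<Longrightarrow> tail_norm n (\<lambda>i. c * x i) = c * tail_norm n x"
  by (simp add: tail_norm_def L2_set_right_distrib)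

lemma tail_norm_cong: "(\<And>i. 2 \<le> i \<Longrightarrow> i < n \<Longrightarrow> x i = y i) \<Longrightarrow> tail_norm n x = tail_norm n y"
  unfolding tail_norm_def by (rule L2_set_cong) auto

lemma tail_norm_eq_0: "(\<And>i. 2 \<le> i \<Longrightarrow> i < n \<Longrightarrow> x i = 0) \<Longrightarrow> tail_norm n x = 0"
  by (simp add: tail_norm_def L2_set_def)

text \<open>\<open>x 1 - x 0\<close> is linear and \<open>tail_norm\<close> is a seminorm, so every
  defining inequality bounds a convex function from above.\<close>

lemma convex_tube:
  assumes n: "n \<ge> 2"
  shows "Rn_convex n (tube n L)"
  unfolding Rn_convex_def
proof (intro ballI)
  fix x y u assume x: "x \<in> tube n L" and y: "y \<in> tube n L" and u: "u \<in> {0..1::real}"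
  let ?z = "\<lambda>i\<in>{..<n}. (1 - u) * x i + u * y i"
  have "tail_norm n ?z = tail_norm n (\<lambda>i. (1 - u) * x i + u * y i)"
    by (rule tail_norm_cong) simp
  also have "\<dots> \<le> (1 - u) * tail_norm n x + u * tail_norm n y"
    using tail_norm_triangle[of n "\<lambda>i. (1 - u) * x i" "\<lambda>i. u * y i"] u by (simp add: tail_norm_cmult)
  finally have t: "tail_norm n ?z \<le> (1 - u) * tail_norm n x + u * tail_norm n y" .
  have z: "?z 0 = (1 - u) * x 0 + u * y 0" "?z 1 = (1 - u) * x 1 + u * y 1"
    using n by auto
  have "?z 1 - ?z 0 = (1 - u) * (x 1 - x 0) + u * (y 1 - y 0)"
    unfolding z by (simp add: algebra_simps)
  then have "\<bar>?z 1 - ?z 0\<bar> \<le> (1 - u) * \<bar>x 1 - x 0\<bar> + u * \<bar>y 1 - y 0\<bar>"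
    using abs_triangle_ineq[of "(1 - u) * (x 1 - x 0)" "u * (y 1 - y 0)"] u by (simp add: abs_mult)
  then have "\<bar>?z 1 - ?z 0\<bar> + tail_norm n ?z \<le>
      (1 - u) * (\<bar>x 1 - x 0\<bar> + tail_norm n x) + u * (\<bar>y 1 - y 0\<bar> + tail_norm n y)"
    using t by (simp add: algebra_simps)
  also have "\<dots> \<le> 2"
    using x y u by (intro convex_bound_le) (auto simp: tube_def)
  finally have "\<bar>?z 1 - ?z 0\<bar> + tail_norm n ?z \<le> 2" .
  moreover have "0 \<le> ?z 0" "?z 0 \<le> L"
    unfolding z using x y u by (auto simp: tube_def intro!: convex_bound_le)
  ultimately show "?z \<in> tube n L"
    by (auto simp: tube_def Rn_def)
qed

lemma topspace_Rn_top: "topspace (Rn_top n) = Rn n"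
  by (simp add: Rn_top_def Rn_def)

lemma continuous_map_coord [continuous_intros]:
  "i < n \<Longrightarrow> continuous_map (Rn_top n) euclideanreal (\<lambda>x. x i)"
  unfolding Rn_top_def using continuous_map_product_projection[of i "{..<n}" "\<lambda>_. euclideanreal"] by simp

text \<open>The tube is a closed subset of a compact box. The side comes from
  \<open>|x 1| <= x 0 + 2 <= L + 2\<close>; the remaining coordinates are at most
  \<open>tail_norm n x <= 2\<close> in absolute value.\<close>

lemma compactin_tube:
  assumes n: "n \<ge> 2"
  shows "compactin (Rn_top n) (tube n L)"
proof (rule closed_compactin)
  let ?B = "{..<n} \<rightarrow>\<^sub>E {-(L + 2)..L + 2}"
  show "compactin (Rn_top n) ?B"
    unfolding Rn_top_def by (simp add: compactin_PiE)
  show "tube n L \<subseteq> ?B"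
  proof
    fix x assume x: "x \<in> tube n L"
    have "x i \<in> {-(L + 2)..L + 2}" if "i < n" for i
    proof (cases "i \<ge> 2")
      case True
      then have "\<bar>x i\<bar> \<le> L2_set (\<lambda>i. \<bar>x i\<bar>) {2..<n}"
        using that by (intro member_le_L2_set) auto
      then have "\<bar>x i\<bar> \<le> tail_norm n x"
        by (simp add: tail_norm_def L2_set_def)
      then have "\<bar>x i\<bar> \<le> L + 2"
        using x by (auto simp: tube_def)
      then show ?thesis by auto
    next
      case False
      then have "i = 0 \<or> i = 1" by auto
      then show ?thesis
        using x order_trans[OF add_increasing2[OF tail_norm_nonneg order_refl], of "\<bar>x 1 - x 0\<bar>" n x 2]
        by (auto simp: tube_def)
    qed
    then show "x \<in> ?B"
      using x by (simp add: tube_def Rn_def PiE_iff)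
  qed
  have c: "closedin (Rn_top n) {x \<in> Rn n. f x \<in> {..c}}"
    if "continuous_map (Rn_top n) euclideanreal f" for f and c :: real
    using closedin_continuous_map_preimage[OF that, of "{..c}"] by (simp add: topspace_Rn_top)
  have "tube n L = {x \<in> Rn n. - x 0 \<in> {..0}} \<inter> {x \<in> Rn n. x 0 \<in> {..L}} \<inter>
      {x \<in> Rn n. \<bar>x 1 - x 0\<bar> + sqrt (\<Sum>i\<in>{2..<n}. (x i)\<^sup>2) \<in> {..2}}"
    by (auto simp: tube_def tail_norm_def L2_set_def)
  moreover have "closedin (Rn_top n) \<dots>"
    using n by (intro closedin_Int c continuous_intros) auto
  ultimately show "closedin (Rn_top n) (tube n L)"
    by simp
qed

text \<open>The centre is the midpoint of the axis. Since \<open>|x 1 - x 0| <= p + q\<close> for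
  the deviations \<open>p\<close>, \<open>q\<close> of the first two coordinates, it suffices that
  \<open>p + q + t <= 2\<close>; Cauchy-Schwarz bounds this sum by the square root of 3.\<close>

lemma cball_subset_tube:
  assumes n: "n \<ge> 2" and L: "L \<ge> 2"
  defines "a \<equiv> \<lambda>i\<in>{..<n}. if i < 2 then L / 2 else 0"
  shows "Rn_cball n a 1 \<subseteq> tube n L"
proof
  fix x assume "x \<in> Rn_cball n a 1"
  then have x: "x \<in> Rn n" and "Rn_dist n a x \<le> 1"
    by (auto simp: Rn_cball_def)
  then have "(Rn_dist n a x)\<^sup>2 \<le> 1"
    by (simp add: Rn_dist_def power_le_one)
  moreover have "tail_norm n (\<lambda>i. a i - x i) = tail_norm n (\<lambda>i. - x i)"
    by (rule tail_norm_cong) (simp add: a_def)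
  moreover have a: "a 0 = L / 2" "a 1 = L / 2"
    using n by (auto simp: a_def)
  ultimately have le: "(L / 2 - x 0)\<^sup>2 + (L / 2 - x 1)\<^sup>2 + (tail_norm n x)\<^sup>2 \<le> 1"
    unfolding Rn_dist_eq[OF n] a tail_norm_minus by simp
  define p q t where "p = \<bar>L / 2 - x 0\<bar>" and "q = \<bar>L / 2 - x 1\<bar>" and "t = tail_norm n x"
  have pqt: "p\<^sup>2 + q\<^sup>2 + t\<^sup>2 \<le> 1"
    using le by (simp add: p_def q_def t_def)
  \<comment> \<open>Cauchy-Schwarz for three terms, with its defect written out as squares.\<close>
  have "(p + q + t)\<^sup>2 = 3 * (p\<^sup>2 + q\<^sup>2 + t\<^sup>2) - (p - q)\<^sup>2 - (p - t)\<^sup>2 - (q - t)\<^sup>2"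
    by (simp add: power2_eq_square algebra_simps)
  also have "\<dots> \<le> 4"
  proof -
    have "3 * s - b - c - d \<le> 4" if "s \<le> 1" "0 \<le> b" "0 \<le> c" "0 \<le> d" for s b c d :: real
      using that by linarith
    then show ?thesis using pqt by (simp only: zero_le_power2)
  qed
  finally have sum: "p + q + t \<le> 2"
    using power2_le_imp_le[of "p + q + t" 2] by simp
  have "p\<^sup>2 \<le> p\<^sup>2 + q\<^sup>2 + t\<^sup>2"
    by simp
  also note pqt
  finally have "p \<le> 1"
    using power2_le_imp_le[of p 1] by simp
  with sum show "x \<in> tube n L"
    using x L by (auto simp: tube_def p_def q_def t_def)
qed

lemma convex_body_tube:
  assumes n: "n \<ge> 2" and L: "L \<ge> 2"
  shows "convex_body n (tube n L)"
proof -
  define a where "a = (\<lambda>i\<in>{..<n}. if i < 2 then L / 2 else 0 :: real)"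
  define U where "U = {x \<in> topspace (Rn_top n). sqrt (\<Sum>i\<in>{..<n}. (a i - x i)\<^sup>2) \<in> {..<1}}"
  have "openin (Rn_top n) U"
    unfolding U_def
    by (rule openin_continuous_map_preimage[where Y = euclideanreal]) (intro continuous_intros | simp)+
  moreover have "U \<subseteq> Rn_cball n a 1"
    by (auto simp: U_def Rn_cball_def topspace_Rn_top Rn_dist_def L2_set_def)
  then have "U \<subseteq> tube n L"
    using cball_subset_tube[OF n L] unfolding a_def by blast
  moreover have "a \<in> U"
    by (simp add: U_def topspace_Rn_top a_def Rn_def)
  ultimately have "Rn_top n interior_of tube n L \<noteq> {}"
    using interior_of_maximal[of U "tube n L" "Rn_top n"] by auto
  then show ?thesis
    using n by (simp add: convex_body_def convex_tube compactin_tube)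
qed

text \<open>The distance is attained between the apexes \<open>(0, -2, 0)\<close> and
  \<open>(L, L + 2, 0)\<close> of the two end slices. For the upper bound,
  \<open>|u 1 - v 1|\<close> is at most \<open>L + (2 - |y|) + (2 - |y'|)\<close>, where
  \<open>y\<close> and \<open>y'\<close> are the tails of \<open>u\<close> and \<open>v\<close>.
  Adding the distance of the tails cancels their norms and leaves at most
  \<open>L + 4\<close>.\<close>

lemma diameter_tube:
  assumes n: "n \<ge> 2" and L: "L \<ge> 0"
  shows "Rn_diameter n (tube n L) = sqrt (L\<^sup>2 + (L + 4)\<^sup>2)"
proof -
  define x where "x = (\<lambda>i\<in>{..<n}. if i = 1 then - 2 else 0 :: real)"
  define y where "y = (\<lambda>i\<in>{..<n}. if i = 0 then L else if i = 1 then L + 2 else 0 :: real)"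
  have xy: "x 0 = 0" "x 1 = - 2" "y 0 = L" "y 1 = L + 2"
    using n by (auto simp: x_def y_def)
  have t: "tail_norm n x = 0" "tail_norm n y = 0" "tail_norm n (\<lambda>i. x i - y i) = 0"
    by (rule tail_norm_eq_0; simp add: x_def y_def)+
  have "x \<in> Rn n" "y \<in> Rn n"
    by (auto simp: x_def y_def Rn_def)
  then have mem: "x \<in> tube n L" "y \<in> tube n L"
    using L xy t by (auto simp: tube_def)
  have d: "Rn_dist n x y = sqrt (L\<^sup>2 + (L + 4)\<^sup>2)"
  proof -
    have "(Rn_dist n x y)\<^sup>2 = L\<^sup>2 + (L + 4)\<^sup>2"
      unfolding Rn_dist_eq[OF n] xy t by (simp add: power2_eq_square algebra_simps)
    then show ?thesis
      by (metis Rn_dist_def L2_set_nonneg real_sqrt_unique)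
  qed
  have le: "Rn_dist n u v \<le> sqrt (L\<^sup>2 + (L + 4)\<^sup>2)" if u: "u \<in> tube n L" and v: "v \<in> tube n L" for u v
  proof (rule real_le_rsqrt)
    let ?t = "tail_norm n (\<lambda>i. u i - v i)"
    have "?t \<le> tail_norm n u + tail_norm n v"
      using tail_norm_triangle[of n u "\<lambda>i. - v i"] by (simp add: tail_norm_minus)
    then have 1: "\<bar>u 1 - v 1\<bar> + ?t \<le> L + 4" and 2: "\<bar>u 0 - v 0\<bar> \<le> L"
      using u v by (auto simp: tube_def)
    have "(u 1 - v 1)\<^sup>2 + ?t\<^sup>2 \<le> (\<bar>u 1 - v 1\<bar> + ?t)\<^sup>2"
      by (simp add: power2_sum)
    also have "\<dots> \<le> (L + 4)\<^sup>2"
      using 1 by (intro power_mono) auto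
    finally have "(u 1 - v 1)\<^sup>2 + ?t\<^sup>2 \<le> (L + 4)\<^sup>2" .
    moreover have "(u 0 - v 0)\<^sup>2 \<le> L\<^sup>2"
      using 2 by (metis abs_ge_zero power2_abs power_mono)
    ultimately show "(Rn_dist n u v)\<^sup>2 \<le> L\<^sup>2 + (L + 4)\<^sup>2"
      by (simp add: Rn_dist_eq[OF n])
  qed
  have "(SUP (u, v)\<in>tube n L \<times> tube n L. Rn_dist n u v) = sqrt (L\<^sup>2 + (L + 4)\<^sup>2)"
  proof (rule cSup_eq_maximum)
    show "sqrt (L\<^sup>2 + (L + 4)\<^sup>2) \<in> (\<lambda>(u, v). Rn_dist n u v) ` (tube n L \<times> tube n L)"
      using mem d by (intro image_eqI[of _ _ "(x, y)"]) auto
  qed (use le in auto)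
  then show ?thesis
    using mem by (auto simp: Rn_diameter_def)
qed

section \<open>Choice of the length and conclusion\<close>

theorem theorem5:
  "\<exists>c::real. c > 0 \<and> (\<exists>D0::real. D0 > 0 \<and> (\<forall>n::nat. n \<ge> 2 \<longrightarrow> (\<forall>D::real. D \<ge> D0 \<longrightarrow> (\<exists>K.
     convex_body n K \<and>
     (\<exists>a\<in>Rn n. Rn_cball n a 1 \<subseteq> K) \<and>
     Rn_diameter n K = D \<and>
     conductance n K \<le> c / (real n powr (3/2) * D)))))"
proof (rule exI[of _ 64], intro conjI, simp, rule exI[of _ 10], intro conjI allI impI)
  fix n :: nat and D :: real
  assume n: "n \<ge> 2" and D: "D \<ge> 10"
  \<comment> \<open>The positive solution of \<open>L^2 + (L + 4)^2 = D^2\<close>, which makes the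
    diameter equal to \<open>D\<close>.\<close>
  define L where "L = sqrt (D\<^sup>2 / 2 - 4) - 2"
  have "10 * D \<le> D\<^sup>2"
    using D by (simp add: power2_eq_square mult_right_mono)
  \<comment> \<open>This is \<open>D / 4 <= L\<close> in squared form; \<open>D >= 10\<close> makes
    it hold and also gives \<open>L >= 2\<close>.\<close>
  then have le: "(D / 4 + 2)\<^sup>2 \<le> D\<^sup>2 / 2 - 4"
    using D by (simp add: power2_sum power_divide)
  have "D / 4 + 2 \<le> sqrt (D\<^sup>2 / 2 - 4)" "0 \<le> D\<^sup>2 / 2 - 4"
    using real_le_rsqrt[OF le] order_trans[OF zero_le_power2 le] by auto
  then have L: "L \<ge> D / 4" and L2: "(L + 2)\<^sup>2 = D\<^sup>2 / 2 - 4"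
    by (simp_all add: L_def)
  then have "L \<ge> 2"
    using D by simp
  have "L\<^sup>2 + (L + 4)\<^sup>2 = D\<^sup>2"
    using L2 by (simp add: power2_eq_square algebra_simps)
  then have diam: "Rn_diameter n (tube n L) = D"
    using diameter_tube[OF n, of L] \<open>L \<ge> 2\<close> D by simp
  \<comment> \<open>The bound obtained has order \<open>1 / (n^2 * D)\<close>; it is weakened to the
    exponent 3/2 here.\<close>
  have "real n powr (3/2) \<le> real n powr 2"
    using n by (intro powr_mono) auto
  also have "\<dots> = (real n)\<^sup>2"
    using n by simp
  finally have "real n powr (3/2) * D \<le> (real n)\<^sup>2 * (4 * L)"
    using L D by (intro mult_mono) auto
  have "conductance n (tube n L) \<le> 16 / ((real n)\<^sup>2 * L)"
    using conductance_tube_le[OF n, of L] \<open>L \<ge> 2\<close> by simp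
  \<comment> \<open>The constant is \<open>64 = 4 * 16\<close>, the factor 4 coming from
    \<open>D <= 4 * L\<close>.\<close>
  also have "\<dots> = 64 / ((real n)\<^sup>2 * (4 * L))"
    by simp
  also have "\<dots> \<le> 64 / (real n powr (3/2) * D)"
    using \<open>real n powr (3/2) * D \<le> _\<close> n D \<open>L \<ge> 2\<close> by (intro divide_left_mono) auto
  finally have cond: "conductance n (tube n L) \<le> 64 / (real n powr (3/2) * D)" .
  define a where "a = (\<lambda>i\<in>{..<n}. if i < 2 then L / 2 else 0)"
  have "a \<in> Rn n" "Rn_cball n a 1 \<subseteq> tube n L"
    using cball_subset_tube[OF n \<open>L \<ge> 2\<close>] by (simp_all add: a_def Rn_def)
  then show "\<exists>K. convex_body n K \<and> (\<exists>a\<in>Rn n. Rn_cball n a 1 \<subseteq> K) \<and> Rn_diameter n K = D \<and>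
      conductance n K \<le> 64 / (real n powr (3/2) * D)"
    using convex_body_tube[OF n \<open>L \<ge> 2\<close>] diam cond by blast
qed auto

end
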